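(* Let $k\ge 2$ and $n\ge 50k^2$ be integers, let $X=\{1,\dots,n\}$, and let $\mathcal F\subset\binom{X}{k}$ be an intersecting family. Then $$|\mathcal I(\mathcal F)|\le |\mathcal I(\mathcal A)|,$$ where $\mathcal A=\left\{A\in\binom{X}{k}\colon |A\cap\{1,2,3\}|\ge 2\right\}$.
   Context: $\binom{X}{k}$ denotes the family of all $k$-element subsets of $X$. A family $\mathcal F$ is intersecting if $F\cap F'\neq\emptyset$ for all $F,F'\in\mathcal F$. For a family $\mathcal F$, $\mathcal I(\mathcal F):=\{F\cap F'\colon F,F'\in\mathcal F,\ F\neq F'\}$ is the family of all distinct pairwise intersections of distinct members. *)

theory Defs
  imports Main
begin

definition k_subsets :: "'a set \<Rightarrow> nat \<Rightarrow> 'a set set" where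
  "k_subsets X k = {A. A \<subseteq> X \<and> card A = k}"

definition intersecting :: "'a set set \<Rightarrow> bool" where
  "intersecting \<F> \<longleftrightarrow> (\<forall>F\<in>\<F>. \<forall>F'\<in>\<F>. F \<inter> F' \<noteq> {})"

definition intersections :: "'a set set \<Rightarrow> 'a set set" where
  "intersections \<F> = {F \<inter> F' | F F'. F \<in> \<F> \<and> F' \<in> \<F> \<and> F \<noteq> F'}"

end

theory Submission
  imports Defs
begin

text \<open>
  Enlarge the family to a maximal intersecting family \<open>\<M>\<close>; its covers (transversals of size at
  most \<open>k\<close>) then pairwise intersect. Let \<open>m\<close> be the least size such that the covers of size at most
  \<open>m\<close> have no point in common. If there is no such \<open>m \<le> k\<close>, then \<open>\<M>\<close> is a star and has few
  intersections. If \<open>m \<le> 2\<close>, the covers of size two form a triangle, and \<open>\<M>\<close> lies in a copy of the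
  extremal family. Otherwise let \<open>v\<close> lie in all covers of size less than \<open>m\<close>. Intersections of size
  at most \<open>k - 2\<close> are bounded by the number of all such sets, intersections of size \<open>k - 1\<close> through
  \<open>v\<close> by \<open>(n - 1) choose (k - 2)\<close>. Any other intersection of size \<open>k - 1\<close> is a member avoiding
  \<open>v\<close> minus one point. A member \<open>F\<close> avoiding \<open>v\<close> contains no cover smaller than \<open>m\<close>, so an
  \<open>m\<close>-subset of \<open>F\<close> can be chosen by branching: the first two points from covers of size at most
  \<open>m\<close>, the others from members of \<open>\<M>\<close>. This leaves only \<open>m\<^sup>2 k\<^bsup>m-2\<^esup>\<close> choices, and it is the gain
  of two factors \<open>m\<close> in place of \<open>k\<close> that makes \<open>n \<ge> 50 k\<^sup>2\<close> suffice. Altogether there are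
  about \<open>2.54 (n choose (k - 2))\<close> intersections at most, against about \<open>3 (n choose (k - 2))\<close>
  for the extremal family.
\<close>

section \<open>Elementary counting and the branching process\<close>

lemma card_supersets_le:
  assumes "finite X" "Z \<subseteq> X"
  shows "card {A. Z \<subseteq> A \<and> A \<subseteq> X \<and> card A = k} \<le> (card X - card Z) choose (k - card Z)"
proof -
  have fZ: "finite Z" using assms finite_subset by blast
  have "card {A. Z \<subseteq> A \<and> A \<subseteq> X \<and> card A = k} \<le> card {B. B \<subseteq> X - Z \<and> card B = k - card Z}"
  proof (rule card_inj_on_le)
    show "inj_on (\<lambda>A. A - Z) {A. Z \<subseteq> A \<and> A \<subseteq> X \<and> card A = k}"
      by (rule inj_onI) blast
    show "(\<lambda>A. A - Z) ` {A. Z \<subseteq> A \<and> A \<subseteq> X \<and> card A = k} \<subseteq> {B. B \<subseteq> X - Z \<and> card B = k - card Z}"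
      using fZ by (auto simp: card_Diff_subset)
    show "finite {B. B \<subseteq> X - Z \<and> card B = k - card Z}" using assms(1) by simp
  qed
  also have "\<dots> = card (X - Z) choose (k - card Z)"
    using assms(1) by (simp add: n_subsets)
  also have "card (X - Z) = card X - card Z"
    using fZ assms(2) by (simp add: card_Diff_subset)
  finally show ?thesis .
qed

lemma card_subsets_atMost:
  assumes "finite X"
  shows "card {A. A \<subseteq> X \<and> card A \<le> d} = (\<Sum>i\<le>d. card X choose i)"
proof -
  have "{A. A \<subseteq> X \<and> card A \<le> d} = (\<Union>i\<le>d. {A. A \<subseteq> X \<and> card A = i})" by auto
  also have "card \<dots> = (\<Sum>i\<le>d. card {A. A \<subseteq> X \<and> card A = i})"
    using assms by (intro card_UN_disjoint) auto
  finally show ?thesis using assms by (simp add: n_subsets)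
qed

lemma card_UN_le_mult:
  assumes "finite I" "card I \<le> a" "\<And>i. i \<in> I \<Longrightarrow> card (A i) \<le> b"
  shows "card (\<Union>i\<in>I. A i) \<le> a * b"
proof -
  have "card (\<Union>i\<in>I. A i) \<le> (\<Sum>i\<in>I. card (A i))" using assms(1) by (rule card_UN_le)
  also have "\<dots> \<le> card I * b" using sum_bounded_above[of I "\<lambda>i. card (A i)" b] assms(3) by simp
  also have "\<dots> \<le> a * b" using assms(2) by simp
  finally show ?thesis .
qed

text \<open>Grow the sets one point at a time: \<open>W\<close> meets every member of
  \<open>\<G>\<close>, so a member containing \<open>Z\<close> also contains some
  \<open>insert w Z\<close> with \<open>w\<close> in \<open>W\<close>. Level \<open>j\<close>
  multiplies the number of sets by at most \<open>c j\<close>. Only sets lying inside some member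
  are kept, so \<open>W\<close> has to be supplied for those alone.\<close>

lemma branching:
  fixes \<G> :: "'a set set" and c :: "nat \<Rightarrow> nat"
  assumes "\<And>Z. finite Z \<Longrightarrow> card Z < m \<Longrightarrow> \<exists>F\<in>\<G>. Z \<subseteq> F \<Longrightarrow>
    \<exists>W. finite W \<and> card W \<le> c (card Z) \<and> W \<inter> Z = {} \<and> (\<forall>F\<in>\<G>. W \<inter> F \<noteq> {})"
  shows "\<exists>\<Z>. finite \<Z> \<and> card \<Z> \<le> (\<Prod>j<m. c j) \<and> (\<forall>Z\<in>\<Z>. finite Z \<and> card Z = m)
    \<and> (\<forall>Z\<in>\<Z>. \<exists>F\<in>\<G>. Z \<subseteq> F) \<and> (\<forall>F\<in>\<G>. \<exists>Z\<in>\<Z>. Z \<subseteq> F)"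
  using assms
proof (induction m)
  case 0
  show ?case
  \<comment> \<open>The family consisting of the empty set is no answer for empty
    \<open>\<G>\<close>, as each chosen set must lie in a member.\<close>
  proof (cases "\<G> = {}")
    case True
    then show ?thesis by (intro exI[of _ "{}"]) simp
  next
    case False
    then show ?thesis by (intro exI[of _ "{{}}"]) auto
  qed
next
  case (Suc m)
  have "\<exists>\<Z>. finite \<Z> \<and> card \<Z> \<le> (\<Prod>j<m. c j) \<and> (\<forall>Z\<in>\<Z>. finite Z \<and> card Z = m)
    \<and> (\<forall>Z\<in>\<Z>. \<exists>F\<in>\<G>. Z \<subseteq> F) \<and> (\<forall>F\<in>\<G>. \<exists>Z\<in>\<Z>. Z \<subseteq> F)"
  proof (rule Suc.IH)
    fix Z assume "finite Z" "card Z < m" "\<exists>F\<in>\<G>. Z \<subseteq> F"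
    then show "\<exists>W. finite W \<and> card W \<le> c (card Z) \<and> W \<inter> Z = {} \<and> (\<forall>F\<in>\<G>. W \<inter> F \<noteq> {})"
      by (intro Suc.prems) simp_all
  qed
  then obtain \<Z> where Z: "finite \<Z>" "card \<Z> \<le> (\<Prod>j<m. c j)" "\<forall>Z\<in>\<Z>. finite Z \<and> card Z = m"
    "\<forall>Z\<in>\<Z>. \<exists>F\<in>\<G>. Z \<subseteq> F" "\<forall>F\<in>\<G>. \<exists>Z\<in>\<Z>. Z \<subseteq> F"
    by (elim exE conjE)
  have "\<forall>Z\<in>\<Z>. \<exists>W. finite W \<and> card W \<le> c m \<and> W \<inter> Z = {} \<and> (\<forall>F\<in>\<G>. W \<inter> F \<noteq> {})"
  proof
    fix Z assume Z': "Z \<in> \<Z>"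
    then show "\<exists>W. finite W \<and> card W \<le> c m \<and> W \<inter> Z = {} \<and> (\<forall>F\<in>\<G>. W \<inter> F \<noteq> {})"
      using Suc.prems[of Z] Z(3,4) by simp
  qed
  from bchoice[OF this] obtain W where "\<forall>Z\<in>\<Z>. finite (W Z) \<and> card (W Z) \<le> c m \<and> W Z \<inter> Z = {}
      \<and> (\<forall>F\<in>\<G>. W Z \<inter> F \<noteq> {})"
    by (elim exE)
  note W = this[rule_format]
  define \<Y> where "\<Y> = (\<Union>Z\<in>\<Z>. (\<lambda>w. insert w Z) ` W Z)"
  define \<Y>' where "\<Y>' = {Y\<in>\<Y>. \<exists>F\<in>\<G>. Y \<subseteq> F}"
  have finY: "finite \<Y>" unfolding \<Y>_def using Z(1) W by blast
  have "card \<Y> \<le> (\<Prod>j<m. c j) * c m"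
    unfolding \<Y>_def
  proof (rule card_UN_le_mult[OF Z(1,2)])
    fix Z assume "Z \<in> \<Z>"
    then show "card ((\<lambda>w. insert w Z) ` W Z) \<le> c m"
      using W[of Z] card_image_le[of "W Z" "\<lambda>w. insert w Z"] by linarith
  qed
  moreover have "card \<Y>' \<le> card \<Y>" unfolding \<Y>'_def using finY by (intro card_mono) auto
  ultimately have card: "card \<Y>' \<le> (\<Prod>j<Suc m. c j)" by simp
  \<comment> \<open>Disjointness of \<open>W Z\<close> and \<open>Z\<close> makes each insertion add
    a new point.\<close>
  have "\<forall>Y\<in>\<Y>'. finite Y \<and> card Y = Suc m"
    unfolding \<Y>'_def \<Y>_def using W Z(3) by (fastforce simp: card_insert_if)
  moreover have "\<exists>Y\<in>\<Y>'. Y \<subseteq> F" if F: "F \<in> \<G>" for F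
  proof -
    obtain Z where ZF: "Z \<in> \<Z>" "Z \<subseteq> F" using Z(5) F by blast
    obtain w where "w \<in> W Z" "w \<in> F" using W ZF(1) F by blast
    then show ?thesis unfolding \<Y>'_def \<Y>_def using ZF F by (intro bexI[of _ "insert w Z"]) auto
  qed
  ultimately show ?case using card finY unfolding \<Y>'_def
    by (intro exI[of _ "{Y\<in>\<Y>. \<exists>F\<in>\<G>. Y \<subseteq> F}"]) auto
qed

section \<open>Covers and saturated intersecting families\<close>

definition covers :: "'a set set \<Rightarrow> 'a set \<Rightarrow> nat \<Rightarrow> 'a set set" where
  "covers \<F> X s = {T. T \<subseteq> X \<and> card T \<le> s \<and> (\<forall>F\<in>\<F>. T \<inter> F \<noteq> {})}"

lemma finite_k_subsets: "finite X \<Longrightarrow> finite (k_subsets X k)"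
  by (simp add: k_subsets_def)

lemma intersections_mono: "\<F> \<subseteq> \<G> \<Longrightarrow> intersections \<F> \<subseteq> intersections \<G>"
  unfolding intersections_def by blast

lemma intersectionsI: "F \<in> \<F> \<Longrightarrow> F' \<in> \<F> \<Longrightarrow> F \<noteq> F' \<Longrightarrow> F \<inter> F' \<in> intersections \<F>"
  unfolding intersections_def by blast

lemma finite_intersections:
  assumes "finite X" "\<F> \<subseteq> k_subsets X k"
  shows "finite (intersections \<F>)"
proof (rule finite_subset)
  show "intersections \<F> \<subseteq> Pow X" using assms(2) by (auto simp: intersections_def k_subsets_def)
qed (use assms(1) in simp)

lemma ex_saturated_intersecting:
  assumes "finite X" "\<F> \<subseteq> k_subsets X k" "intersecting \<F>"
  obtains \<M> where "\<F> \<subseteq> \<M>" "\<M> \<subseteq> k_subsets X k" "intersecting \<M>"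
    "\<And>A. A \<in> k_subsets X k \<Longrightarrow> intersecting (insert A \<M>) \<Longrightarrow> A \<in> \<M>"
proof -
  let ?P = "{\<M>. \<M> \<subseteq> k_subsets X k \<and> intersecting \<M>}"
  have "finite ?P" using finite_k_subsets[OF assms(1)] by simp
  moreover have "\<F> \<in> ?P" using assms by simp
  ultimately obtain \<M> where M: "\<M> \<in> ?P" "\<F> \<subseteq> \<M>" "\<forall>\<N>\<in>?P. \<M> \<subseteq> \<N> \<longrightarrow> \<M> = \<N>"
    using finite_has_maximal2[of ?P \<F>] by blast
  show ?thesis
  proof (rule that)
    fix A assume A: "A \<in> k_subsets X k" "intersecting (insert A \<M>)"
    then have "insert A \<M> \<in> ?P" using M(1) by simp
    from bspec[OF M(3) this] have "\<M> = insert A \<M>" by (simp add: subset_insertI)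
    then show "A \<in> \<M>" by (metis insertI1)
  qed (use M in auto)
qed

text \<open>If \<open>S\<close> and \<open>T\<close> were disjoint, \<open>S\<close> could be
  extended to a \<open>k\<close>-set \<open>A\<close> outside \<open>T\<close>, there being at least
  \<open>k\<close> points outside \<open>T\<close>. As \<open>A\<close> contains a cover, saturation
  makes it a member, which \<open>T\<close> then fails to meet.\<close>

lemma saturated_covers_intersect:
  assumes "finite X" "2 * k \<le> card X" "1 \<le> k" "\<M> \<subseteq> k_subsets X k" "intersecting \<M>"
    and sat: "\<And>A. A \<in> k_subsets X k \<Longrightarrow> intersecting (insert A \<M>) \<Longrightarrow> A \<in> \<M>"
    and S: "S \<in> covers \<M> X k" and T: "T \<in> covers \<M> X k"
  shows "S \<inter> T \<noteq> {}"
proof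
  assume disj: "S \<inter> T = {}"
  have fin: "finite S" "finite T" using S T assms(1) by (auto simp: covers_def intro: finite_subset)
  have "card (X - T) \<ge> k"
    using T fin assms(2) by (auto simp: covers_def card_Diff_subset)
  moreover have "S \<subseteq> X - T" "card S \<le> k" using S disj by (auto simp: covers_def)
  ultimately obtain A where A: "S \<subseteq> A" "A \<subseteq> X - T" "card A = k"
    using exists_subset_between[of S k "X - T"] assms(1) by auto
  \<comment> \<open>\<open>intersecting\<close> also compares \<open>A\<close> with itself;
    \<open>1 \<le> k\<close> makes \<open>A\<close> nonempty.\<close>
  have "intersecting (insert A \<M>)"
    using A S assms(3,5) by (auto simp: intersecting_def covers_def) blast+
  moreover have "A \<in> k_subsets X k" using A by (auto simp: k_subsets_def)
  ultimately have "A \<in> \<M>" using sat by simp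
  then show False using T A(2) by (auto simp: covers_def)
qed

section \<open>The extremal family on an arbitrary triple\<close>

definition two_of_three :: "'a set \<Rightarrow> nat \<Rightarrow> 'a set \<Rightarrow> 'a set set" where
  "two_of_three X k Y = {A \<in> k_subsets X k. card (A \<inter> Y) \<ge> 2}"

text \<open>A permutation of \<open>X\<close> taking \<open>Y\<close> to \<open>Y'\<close> maps
  intersections injectively to intersections. This moves a triangle found anywhere in
  \<open>X\<close> to the triple \<open>{1,2,3}\<close>.\<close>

lemma card_intersections_two_of_three_le:
  assumes "finite X" "Y \<subseteq> X" "Y' \<subseteq> X" "card Y = card Y'"
  shows "card (intersections (two_of_three X k Y)) \<le> card (intersections (two_of_three X k Y'))"
proof -
  have fY: "finite Y" "finite Y'" using assms finite_subset by auto
  obtain g where g: "bij_betw g Y Y'" using fY assms(4) finite_same_card_bij by blast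
  have "card (X - Y) = card (X - Y')" using fY assms by (simp add: card_Diff_subset)
  then obtain h where h: "bij_betw h (X - Y) (X - Y')"
    using assms(1) finite_same_card_bij by blast
  define f where "f = (\<lambda>x. if x \<in> Y then g x else h x)"
  have fYY: "bij_betw f Y Y'" using g by (subst bij_betw_cong[of Y f g]) (auto simp: f_def)
  have "bij_betw f (X - Y) (X - Y')" using h by (subst bij_betw_cong[of _ f h]) (auto simp: f_def)
  then have "bij_betw f (Y \<union> (X - Y)) (Y' \<union> (X - Y'))"
    using fYY by (intro bij_betw_combine) auto
  then have f: "bij_betw f X X" using assms by (simp add: Un_absorb1)
  then have inj: "inj_on f X" and im: "f ` X = X" by (auto simp: bij_betw_def)
  have imY: "f ` Y = Y'" using fYY by (simp add: bij_betw_def)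
  have im2: "f ` A \<in> two_of_three X k Y'" if "A \<in> two_of_three X k Y" for A
  proof -
    have A: "A \<subseteq> X" "card A = k" "card (A \<inter> Y) \<ge> 2" using that by (auto simp: two_of_three_def k_subsets_def)
    have "card (f ` A) = k" using A inj by (metis card_image inj_on_subset)
    moreover have "f ` A \<inter> Y' = f ` (A \<inter> Y)"
      using inj_on_image_Int[OF inj A(1) assms(2)] imY by simp
    moreover have "card (f ` (A \<inter> Y)) = card (A \<inter> Y)"
      using A inj by (meson card_image inf.coboundedI1 inj_on_subset)
    moreover have "f ` A \<subseteq> X" using A im by blast
    ultimately show ?thesis using A by (simp add: two_of_three_def k_subsets_def)
  qed
  show ?thesis
  proof (rule card_inj_on_le)
    have sub: "two_of_three X k Z \<subseteq> k_subsets X k" for Z by (auto simp: two_of_three_def)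
    then show "finite (intersections (two_of_three X k Y'))" by (rule finite_intersections[OF assms(1)])
    have "intersections (two_of_three X k Y) \<subseteq> Pow X"
      by (auto simp: intersections_def two_of_three_def k_subsets_def)
    then show "inj_on ((`) f) (intersections (two_of_three X k Y))"
      using inj by (meson inj_on_image_Pow inj_on_subset)
    show "(`) f ` intersections (two_of_three X k Y) \<subseteq> intersections (two_of_three X k Y')"
    proof clarify
      fix I assume "I \<in> intersections (two_of_three X k Y)"
      then obtain A B where AB: "A \<in> two_of_three X k Y" "B \<in> two_of_three X k Y" "A \<noteq> B" "I = A \<inter> B"
        by (auto simp: intersections_def)
      then have X: "A \<subseteq> X" "B \<subseteq> X" by (auto simp: two_of_three_def k_subsets_def)
      have "f ` I = f ` A \<inter> f ` B" using inj_on_image_Int[OF inj X] AB by simp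
      moreover have "f ` A \<noteq> f ` B" using AB(3) inj X by (simp add: inj_on_image_eq_iff)
      ultimately show "f ` I \<in> intersections (two_of_three X k Y')"
        using im2[OF AB(1)] im2[OF AB(2)] intersectionsI by metis
    qed
  qed
qed

text \<open>The sets meeting \<open>Y\<close> in exactly one point suffice for the lower bound.\<close>

lemma card_intersections_two_of_three_ge:
  fixes X Y :: "'a set"
  assumes "finite X" "Y \<subseteq> X" "card Y = 3" "2 \<le> k" "2 * k \<le> card X"
  shows "3 * (\<Sum>i\<le>k-2. (card X - 3) choose i) \<le> card (intersections (two_of_three X k Y))"
proof -
  let ?S = "{T. T \<subseteq> X - Y \<and> card T \<le> k - 2}"
  have fY: "finite Y" using assms finite_subset by auto
  have cXY: "card (X - Y) = card X - 3" using fY assms by (simp add: card_Diff_subset)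
  have "card ?S = (\<Sum>i\<le>k-2. (card X - 3) choose i)"
    using card_subsets_atMost[of "X - Y" "k - 2"] assms(1) cXY by simp
  then have "3 * (\<Sum>i\<le>k-2. (card X - 3) choose i) = card (Y \<times> ?S)"
    using assms(3) by (simp add: card_cartesian_product)
  also have "\<dots> \<le> card (intersections (two_of_three X k Y))"
  proof (rule card_inj_on_le)
    show "inj_on (\<lambda>(a, T). insert a T) (Y \<times> ?S)"
    proof (rule inj_onI, clarify)
      fix a T b U
      assume "a \<in> Y" "b \<in> Y" "T \<subseteq> X - Y" "U \<subseteq> X - Y" and eq: "insert a T = insert b U"
      then have "insert a T \<inter> Y = {a}" "insert b U \<inter> Y = {b}" "insert a T - Y = T" "insert b U - Y = U"
        by auto
      then show "a = b \<and> T = U" using eq by auto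
    qed
    show "finite (intersections (two_of_three X k Y))"
      by (rule finite_intersections[OF assms(1), of _ k]) (auto simp: two_of_three_def)
    show "(\<lambda>(a, T). insert a T) ` (Y \<times> ?S) \<subseteq> intersections (two_of_three X k Y)"
    proof clarify
      fix a T assume a: "a \<in> Y" and T: "T \<subseteq> X - Y" "card T \<le> k - 2"
      have fT: "finite T" using T assms(1) by (meson finite_Diff finite_subset)
      obtain b c where bc: "Y = {a, b, c}" "a \<noteq> b" "a \<noteq> c" "b \<noteq> c"
      proof -
        have "card (Y - {a}) = 2" using a assms(3) by simp
        then obtain b c where "Y - {a} = {b, c}" "b \<noteq> c" by (meson card_2_iff)
        then show ?thesis using that[of b c] a by blast
      qed
      \<comment> \<open>Pad \<open>T\<close> to size \<open>k - 2\<close> in two ways, by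
        \<open>U\<close> and by \<open>T \<union> V\<close> with \<open>V\<close> disjoint from
        \<open>U\<close>, so that only \<open>T\<close> is common. Adding \<open>a, b\<close> to one
        and \<open>a, c\<close> to the other gives two members meeting exactly in
        \<open>insert a T\<close>; \<open>2 * k \<le> card X\<close> leaves room for
        \<open>V\<close>.\<close>
      have "k - 2 \<le> card (X - Y)" using cXY assms by simp
      then obtain U where U: "T \<subseteq> U" "U \<subseteq> X - Y" "card U = k - 2"
        using exists_subset_between[of T "k - 2" "X - Y"] T assms(1) by auto
      have fU: "finite U" using U assms(1) by (meson finite_Diff finite_subset)
      have "k - 2 - card T \<le> card (X - Y - U)"
        using U fU cXY assms by (simp add: card_Diff_subset)
      then obtain V where V: "V \<subseteq> X - Y - U" "card V = k - 2 - card T"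
        using obtain_subset_with_card_n by metis
      have fV: "finite V" using V assms(1) by (meson finite_Diff finite_subset)
      have disj: "V \<inter> T = {}" using V U by blast
      have cTV: "card (T \<union> V) = k - 2"
        using card_Un_disjoint[of T V] fT fV disj V(2) T(2) by (simp add: Int_commute)
      have A: "insert a (insert b U) \<in> two_of_three X k Y"
      proof -
        have "insert a (insert b U) \<inter> Y = {a, b}" using U bc by blast
        moreover have "card (insert a (insert b U)) = k"
        proof -
          have "a \<notin> U" "b \<notin> U" using U bc by auto
          then show ?thesis using bc fU U(3) assms(4) by simp
        qed
        ultimately show ?thesis using U bc assms(2) by (auto simp: two_of_three_def k_subsets_def)
      qed
      have B: "insert a (insert c (T \<union> V)) \<in> two_of_three X k Y"
      proof -
        have "insert a (insert c (T \<union> V)) \<inter> Y = {a, c}" using T V bc by blast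
        moreover have "card (insert a (insert c (T \<union> V))) = k"
        proof -
          have "a \<notin> T \<union> V" "c \<notin> T \<union> V" using T V bc by auto
          then show ?thesis using bc fT fV cTV assms(4) by simp
        qed
        ultimately show ?thesis using T V bc assms(2) by (auto simp: two_of_three_def k_subsets_def)
      qed
      have "b \<notin> insert a (insert c (T \<union> V))" using T V bc by auto
      then have "insert a (insert b U) \<noteq> insert a (insert c (T \<union> V))" by blast
      moreover have "insert a T = insert a (insert b U) \<inter> insert a (insert c (T \<union> V))"
        using T U V bc by auto
      ultimately show "insert a T \<in> intersections (two_of_three X k Y)"
        using A B unfolding intersections_def by blast
    qed
  qed
  finally show ?thesis .
qed

section \<open>Binomial and exponential estimates\<close>

text \<open>The ratio of the two coefficients is \<open>Suc N / (Suc N - i)\<close>, which is at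
  most 21/20 under the hypothesis.\<close>

lemma binomial_Suc_upper_le:
  assumes "21 * i \<le> Suc N"
  shows "20 * (Suc N choose i) \<le> 21 * (N choose i)"
proof -
  have eq: "(Suc N - i) * (Suc N choose i) = Suc N * (N choose i)"
    using binomial_absorb_comp[of "Suc N" i] by simp
  have "20 * Suc N * (Suc N choose i) \<le> 21 * (Suc N - i) * (Suc N choose i)"
    by (rule mult_right_mono) (use assms in simp_all)
  also have "\<dots> = 21 * (Suc N * (N choose i))" using eq by (simp only: mult.assoc)
  finally have "Suc N * (20 * (Suc N choose i)) \<le> Suc N * (21 * (N choose i))"
    by (simp only: ac_simps)
  then show ?thesis by (simp only: mult_le_cancel1)
qed

text \<open>The constants are \<open>20 ^ 3\<close> and \<open>21 ^ 3\<close>.\<close>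

lemma sum_binomial_le:
  assumes "21 * d + 3 \<le> n"
  shows "8000 * (\<Sum>i\<le>d. n choose i) \<le> 9261 * (\<Sum>i\<le>d. (n - 3) choose i)"
proof -
  have "8000 * (n choose i) \<le> 9261 * ((n - 3) choose i)" if "i \<le> d" for i
  proof -
    obtain N where N: "n = Suc (Suc (Suc N))"
      using assms by (intro that[of "n - 3"]) simp
    have "20 * (Suc (Suc (Suc N)) choose i) \<le> 21 * (Suc (Suc N) choose i)"
      "20 * (Suc (Suc N) choose i) \<le> 21 * (Suc N choose i)"
      "20 * (Suc N choose i) \<le> 21 * (N choose i)"
      using that assms N by (intro binomial_Suc_upper_le; simp)+
    then show ?thesis using N by simp
  qed
  then show ?thesis unfolding sum_distrib_left by (intro sum_mono) simp
qed

text \<open>Passing from \<open>m\<close> to \<open>m + 1\<close> divides the binomial coefficient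
  by \<open>(n - m + 1) / (k - m)\<close>, which is at least \<open>50 * k\<close>. The factor
  \<open>k\<close> pays for one more branching, and a factor 50 is left over.\<close>

lemma binomial_branching_le:
  assumes "2 \<le> m" "m \<le> k" "50 * k\<^sup>2 \<le> n"
  shows "(50 * k) ^ (m - 2) * ((n - (m - 1)) choose (k - m)) \<le> (n - 1) choose (k - 2)"
  using assms(1,2)
proof (induction m rule: dec_induct)
  case base
  then show ?case by simp
next
  case (step m)
  have km: "k - m = Suc (k - Suc m)" using step by simp
  have kn: "50 * k * k \<le> n" using assms(3) by (simp add: power2_eq_square)
  have mk: "m < k" using step by simp
  have "50 * k * (k - 1) \<le> n - k"
    using diff_le_mono[OF kn, of "50 * k"] by (simp add: diff_mult_distrib2)
  then have big: "50 * k * (k - m) \<le> n - (m - 1)"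
  proof -
    have "50 * k * (k - m) \<le> 50 * k * (k - 1)" using step(1) by (intro mult_le_mono2) simp
    also have "\<dots> \<le> n - (m - 1)" using \<open>50 * k * (k - 1) \<le> n - k\<close> mk by linarith
    finally show ?thesis .
  qed
  \<comment> \<open>Subtraction is truncated, so \<open>m \<le> n\<close> has to be secured
    first.\<close>
  have nm: "n - (m - 1) = Suc (n - m)"
  proof -
    have "k * 1 \<le> k * (50 * k)" using mk by (intro mult_le_mono2) simp
    moreover have "k * (50 * k) = 50 * k * k" by simp
    ultimately have "k \<le> n" using kn by linarith
    then show ?thesis using mk step(1) by simp
  qed
  have "(k - m) * (50 * k * ((n - m) choose (k - Suc m))) = 50 * k * (k - m) * ((n - m) choose (k - Suc m))"
    by (simp only: ac_simps)
  also have "\<dots> \<le> (n - (m - 1)) * ((n - m) choose (k - Suc m))"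
    using big by (rule mult_right_mono) simp
  also have "\<dots> = (k - m) * ((n - (m - 1)) choose (k - m))"
    using Suc_times_binomial[of "k - Suc m" "n - m"] km nm by simp
  finally have le: "50 * k * ((n - m) choose (k - Suc m)) \<le> (n - (m - 1)) choose (k - m)"
    using mk by simp
  have "(50 * k) ^ (Suc m - 2) * ((n - (Suc m - 1)) choose (k - Suc m))
      = (50 * k) ^ (m - 2) * (50 * k * ((n - m) choose (k - Suc m)))"
  proof -
    have "Suc m - 2 = Suc (m - 2)" using step(1) by simp
    then show ?thesis by (simp only: power_Suc diff_Suc_1 ac_simps)
  qed
  also have "\<dots> \<le> (50 * k) ^ (m - 2) * ((n - (m - 1)) choose (k - m))"
    using le by (rule mult_left_mono) simp
  also have "\<dots> \<le> (n - 1) choose (k - 2)" using step by simp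
  finally show ?case .
qed

text \<open>Equality holds at \<open>m = 3\<close>, whence the constant 27; afterwards the cube
  grows by a factor of at most 8 per step. The cube comes from two branchings of width
  \<open>m\<close> and the choice of one of \<open>m\<close> points to delete.\<close>

lemma cube_le_exponential:
  fixes m :: nat
  assumes "3 \<le> m"
  shows "50 * m ^ 3 \<le> 27 * 50 ^ (m - 2)"
  using assms
proof (induction m rule: dec_induct)
  case base
  then show ?case by simp
next
  case (step m)
  have "Suc m ^ 3 \<le> (2 * m) ^ 3" using step by (intro power_mono) auto
  then have "50 * Suc m ^ 3 \<le> 50 * (50 * m ^ 3)" by (simp add: power_mult_distrib)
  also have "\<dots> \<le> 50 * (27 * 50 ^ (m - 2))" using step by simp
  also have "\<dots> = 27 * 50 ^ (Suc m - 2)"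
  proof -
    have "Suc m - 2 = Suc (m - 2)" using step(1) by simp
    then show ?thesis by simp
  qed
  finally show ?case .
qed

section \<open>Small covers without a common point\<close>

lemma intersections_subset_card:
  assumes "finite X" "\<F> \<subseteq> k_subsets X k" "I \<in> intersections \<F>"
  shows "I \<subseteq> X" "card I < k"
proof -
  obtain F F' where F: "F \<in> \<F>" "F' \<in> \<F>" "F \<noteq> F'" "I = F \<inter> F'"
    using assms(3) by (auto simp: intersections_def)
  then have X: "F \<subseteq> X" "F' \<subseteq> X" "card F = k" "card F' = k" using assms(2) by (auto simp: k_subsets_def)
  then show "I \<subseteq> X" using F by auto
  have fin: "finite F" "finite F'" using X assms(1) finite_subset by auto
  have "F \<inter> F' \<noteq> F" using F X fin by (metis card_subset_eq inf.cobounded2)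
  then have "F \<inter> F' \<subset> F" by blast
  then show "card I < k" using psubset_card_mono[OF fin(1)] F(4) X(3) by simp
qed

text \<open>The covers are edges of a pairwise intersecting graph without a common vertex. From an
  edge \<open>{a, b}\<close>, an edge avoiding \<open>a\<close> is \<open>{b, c}\<close>, and an
  edge avoiding \<open>b\<close> must then be \<open>{a, c}\<close>. A set meeting all three edges
  contains two of the vertices.\<close>

lemma triangle_if_no_common_point:
  assumes "X \<noteq> {}" "finite X" "\<M> \<subseteq> k_subsets X k"
    and int: "\<And>S T. S \<in> covers \<M> X 2 \<Longrightarrow> T \<in> covers \<M> X 2 \<Longrightarrow> S \<inter> T \<noteq> {}"
    and no: "\<And>v. v \<in> X \<Longrightarrow> \<exists>T\<in>covers \<M> X 2. v \<notin> T"
  obtains Y where "Y \<subseteq> X" "card Y = 3" "\<M> \<subseteq> two_of_three X k Y"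
proof -
  have two: "card T = 2" if T: "T \<in> covers \<M> X 2" for T
  proof (rule ccontr)
    have sub: "T \<subseteq> X" "card T \<le> 2" using T by (auto simp: covers_def)
    assume "card T \<noteq> 2"
    moreover have "card T \<noteq> 0" using int[OF T T] sub assms(2) by (auto dest: finite_subset)
    \<comment> \<open>A singleton cover \<open>{u}\<close> would put \<open>u\<close> into every
      cover.\<close>
    ultimately have "card T = 1" using sub by linarith
    then obtain u where u: "T = {u}" by (meson card_1_singletonE)
    then show False using no[of u] int[OF T] sub by blast
  qed
  obtain T0 where T0: "T0 \<in> covers \<M> X 2" using no assms(1) by blast
  obtain a b where ab: "T0 = {a, b}" "a \<noteq> b" using two[OF T0] by (meson card_2_iff)
  have X: "a \<in> X" "b \<in> X" using T0 ab by (auto simp: covers_def)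
  obtain T1 where T1: "T1 \<in> covers \<M> X 2" "a \<notin> T1" using no X by blast
  have "b \<in> T1" using int[OF T0 T1(1)] ab T1(2) by blast
  then obtain c where c: "T1 = {b, c}" "b \<noteq> c" using two[OF T1(1)] by (metis card_2_iff doubleton_eq_iff insertE singletonD)
  obtain T2 where T2: "T2 \<in> covers \<M> X 2" "b \<notin> T2" using no X by blast
  have "a \<in> T2" "c \<in> T2" using int[OF T0 T2(1)] int[OF T1(1) T2(1)] ab c T2(2) by blast+
  moreover have "a \<noteq> c" using T1 c by blast
  ultimately have T2': "T2 = {a, c}" using two[OF T2(1)] by (metis card_2_iff doubleton_eq_iff insertE singletonD)
  show ?thesis
  proof (rule that)
    show "{a, b, c} \<subseteq> X" using X T1 c by (auto simp: covers_def)
    show "card {a, b, c} = 3" using ab c \<open>a \<noteq> c\<close> by simp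
    show "\<M> \<subseteq> two_of_three X k {a, b, c}"
    proof
      fix F assume F: "F \<in> \<M>"
      have "F \<inter> {a, b} \<noteq> {}" "F \<inter> {b, c} \<noteq> {}" "F \<inter> {a, c} \<noteq> {}"
        using F T0 T1 T2 ab c T2' by (auto simp: covers_def Int_commute)
      then have "{a, b} \<subseteq> F \<inter> {a, b, c} \<or> {b, c} \<subseteq> F \<inter> {a, b, c} \<or> {a, c} \<subseteq> F \<inter> {a, b, c}"
        by blast
      moreover have "card {a, b} = 2" "card {b, c} = 2" "card {a, c} = 2" using ab c \<open>a \<noteq> c\<close> by simp_all
      ultimately have "2 \<le> card (F \<inter> {a, b, c})"
        by (metis card_mono finite.emptyI finite_Int finite_insert)
      then show "F \<in> two_of_three X k {a, b, c}" using F assms(3) by (auto simp: two_of_three_def)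
    qed
  qed
qed

section \<open>Counting intersections when the smaller covers share a point\<close>

lemma card_intersections_le:
  assumes "finite X" "card X = n" "50 * k\<^sup>2 \<le> n" "\<M> \<subseteq> k_subsets X k"
    and self: "intersecting \<M>"
    and m: "3 \<le> m" "m \<le> k"
    and v: "v \<in> X" "\<And>T. T \<in> covers \<M> X (m - 1) \<Longrightarrow> v \<in> T"
    and no: "\<And>v. v \<in> X \<Longrightarrow> \<exists>T\<in>covers \<M> X m. v \<notin> T"
    \<comment> \<open>\<open>77 = 50 + 27\<close>: the intersections of size \<open>k - 1\<close> through \<open>v\<close>, and the others\<close>
  shows "50 * card (intersections \<M>) \<le> 50 * (\<Sum>i\<le>k-2. n choose i) + 77 * ((n - 1) choose (k - 2))"
proof -
  let ?\<G> = "{F \<in> \<M>. v \<notin> F}"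
  have finM: "finite F" if "F \<in> \<M>" for F
    using that assms(1,4) by (auto simp: k_subsets_def intro: finite_subset)
  have "\<exists>\<Z>. finite \<Z> \<and> card \<Z> \<le> (\<Prod>j<m. if j < 2 then m else k) \<and> (\<forall>Z\<in>\<Z>. finite Z \<and> card Z = m)
    \<and> (\<forall>Z\<in>\<Z>. \<exists>F\<in>?\<G>. Z \<subseteq> F) \<and> (\<forall>F\<in>?\<G>. \<exists>Z\<in>\<Z>. Z \<subseteq> F)"
  proof (rule branching)
    fix Z assume Z: "finite Z" "card Z < m" "\<exists>F\<in>?\<G>. Z \<subseteq> F"
    then have ZX: "Z \<subseteq> X" "v \<notin> Z" using assms(4) by (auto simp: k_subsets_def)
    show "\<exists>W. finite W \<and> card W \<le> (if card Z < 2 then m else k) \<and> W \<inter> Z = {} \<and> (\<forall>F\<in>?\<G>. W \<inter> F \<noteq> {})"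
    proof (cases "card Z < 2")
      case True
      \<comment> \<open>A set with at most one point lies in some \<open>{u}\<close>, and a cover of
        size at most \<open>m\<close> avoiding \<open>u\<close> exists by \<open>no\<close>. This is
        where width \<open>m\<close> replaces \<open>k\<close>.\<close>
      then have "card Z = 0 \<or> card Z = 1" by linarith
      then obtain u where u: "u \<in> X" "Z \<subseteq> {u}"
        using Z(1) v(1) ZX(1) by (metis card_0_eq card_1_singletonE empty_subsetI insert_subset order_refl)
      obtain T where T: "T \<in> covers \<M> X m" "u \<notin> T" using no u by blast
      then have "finite T" using assms(1) finite_subset by (auto simp: covers_def)
      then show ?thesis using T u True by (intro exI[of _ T]) (auto simp: covers_def)
    next
      case False
      \<comment> \<open>\<open>Z\<close> avoids \<open>v\<close>, so it is too small to be a cover and some member misses it\<close>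
      have "Z \<notin> covers \<M> X (m - 1)" using v ZX by blast
      then obtain F0 where "F0 \<in> \<M>" "Z \<inter> F0 = {}" using ZX Z(2) by (auto simp: covers_def)
      then show ?thesis using False finM assms(4) self
        by (intro exI[of _ F0]) (auto simp: k_subsets_def intersecting_def Int_commute)
    qed
  qed
  then obtain \<Z> where "finite \<Z>" "card \<Z> \<le> (\<Prod>j<m. if j < 2 then m else k)"
    "\<forall>Z\<in>\<Z>. finite Z \<and> card Z = m" "\<forall>Z\<in>\<Z>. \<exists>F\<in>?\<G>. Z \<subseteq> F" "\<forall>F\<in>?\<G>. \<exists>Z\<in>\<Z>. Z \<subseteq> F"
    by (elim exE conjE)
  note Z = this(1,2) this(3-5)[THEN bspec]
  have prod: "(\<Prod>j<p + 2. if j < 2 then m else k) = m\<^sup>2 * k ^ p" for p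
    by (induction p) (simp_all add: numeral_2_eq_2 lessThan_Suc)
  have cZ: "card \<Z> \<le> m\<^sup>2 * k ^ (m - 2)" 
  proof -
    have "m - 2 + 2 = m" using m by simp
    then show ?thesis using Z(2) prod[of "m - 2"] by (simp only:)
  qed
  have ZX: "Z \<subseteq> X" if "Z \<in> \<Z>" for Z using Z(4)[OF that] assms(4) by (auto simp: k_subsets_def)
  let ?L = "\<lambda>I0. {I. I0 \<subseteq> I \<and> I \<subseteq> X \<and> card I = k - 1}"
  let ?S = "{I. I \<subseteq> X \<and> card I \<le> k - 2}"
  let ?P = "\<Union>Z\<in>\<Z>. \<Union>z\<in>Z. ?L (Z - {z})"
  have sub: "intersections \<M> \<subseteq> ?S \<union> ?L {v} \<union> ?P"
  proof
    fix I assume I: "I \<in> intersections \<M>"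
    note I' = intersections_subset_card[OF assms(1,4) I]
    show "I \<in> ?S \<union> ?L {v} \<union> ?P"
    proof (cases "card I \<le> k - 2 \<or> v \<in> I")
      case True
      then show ?thesis using I' by auto
    next
      case False
      then have cI: "card I = k - 1" using I'(2) by linarith
      \<comment> \<open>Since \<open>v\<close> is not in the intersection, one of the two members
        avoids \<open>v\<close>.\<close>
      obtain F where F: "F \<in> ?\<G>" "I \<subseteq> F" using I False unfolding intersections_def by blast
      then have "finite F" "card F = k" using assms(4) finM by (auto simp: k_subsets_def)
      then have "card (F - I) = 1" using F(2) cI m by (simp add: card_Diff_subset finite_subset)
      then obtain x where x: "F - I = {x}" by (meson card_1_singletonE)
      obtain Y where Y: "Y \<in> \<Z>" "Y \<subseteq> F" using Z(5) F by blast
      have "Y \<noteq> {}" using Z(3)[OF Y(1)] m by auto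
      then obtain u where u: "u \<in> Y" by auto
      \<comment> \<open>Only \<open>x\<close> is missing from \<open>I\<close> in \<open>F\<close>,
        so it is the point to delete from \<open>Y\<close> if it lies there. Otherwise
        \<open>Y\<close> is inside \<open>I\<close>, and an arbitrary point is deleted to have size
        \<open>m - 1\<close> in both cases.\<close>
      define z where "z = (if x \<in> Y then x else u)"
      have "F \<subseteq> insert x I" using x by auto
      then have "z \<in> Y" "Y - {z} \<subseteq> I" using u Y(2) unfolding z_def by auto
      then have "I \<in> ?L (Y - {z})" using I'(1) cI by simp
      then have "I \<in> ?P" using Y(1) \<open>z \<in> Y\<close> by (intro UN_I)
      then show ?thesis by (rule UnI2)
    qed
  qed
  have S: "card ?S = (\<Sum>i\<le>k-2. n choose i)" using card_subsets_atMost[OF assms(1)] assms(2) by simp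
  have V: "card (?L {v}) \<le> (n - 1) choose (k - 2)"
  proof -
    have "k - 1 - 1 = k - 2" by simp
    then show ?thesis using card_supersets_le[of X "{v}" "k - 1"] assms(1,2) v(1) m by simp
  qed
  \<comment> \<open>The factors count the choices of \<open>Z\<close>, of the deleted point, and of
    a \<open>(k - 1)\<close>-set containing the remaining \<open>m - 1\<close> points.\<close>
  have P: "card ?P \<le> (m\<^sup>2 * k ^ (m - 2)) * (m * ((n - (m - 1)) choose (k - m)))"
  proof (rule card_UN_le_mult[OF Z(1) cZ])
    fix Y assume Y: "Y \<in> \<Z>"
    show "card (\<Union>z\<in>Y. ?L (Y - {z})) \<le> m * ((n - (m - 1)) choose (k - m))"
    proof (rule card_UN_le_mult)
      fix z assume z: "z \<in> Y"
      have "card (Y - {z}) = m - 1" using z Z(3)[OF Y] by simp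
      moreover have "k - 1 - (m - 1) = k - m" using m by simp
      moreover have "Y - {z} \<subseteq> X" using ZX[OF Y] by blast
      ultimately show "card (?L (Y - {z})) \<le> (n - (m - 1)) choose (k - m)"
        using card_supersets_le[of X "Y - {z}" "k - 1"] assms(1,2) m by simp
    qed (use Z(3)[OF Y] in auto)
  qed
  have "50 * card ?P \<le> 50 * m ^ 3 * (k ^ (m - 2) * ((n - (m - 1)) choose (k - m)))"
    using P by (simp add: power2_eq_square power3_eq_cube ac_simps)
  also have "\<dots> \<le> 27 * 50 ^ (m - 2) * (k ^ (m - 2) * ((n - (m - 1)) choose (k - m)))"
    using cube_le_exponential[OF m(1)] by (rule mult_right_mono) simp
  also have "\<dots> = 27 * ((50 * k) ^ (m - 2) * ((n - (m - 1)) choose (k - m)))"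
    by (simp add: power_mult_distrib)
  also have "\<dots> \<le> 27 * ((n - 1) choose (k - 2))"
    using binomial_branching_le[OF _ m(2) assms(3)] m(1) by simp
  finally have P': "50 * card ?P \<le> 27 * ((n - 1) choose (k - 2))" .
  have "finite (?S \<union> ?L {v} \<union> ?P)"
    by (rule finite_subset[of _ "Pow X"]) (use assms(1) in auto)
  then have "card (intersections \<M>) \<le> card (?S \<union> ?L {v} \<union> ?P)" using sub by (rule card_mono)
  also have "\<dots> \<le> card ?S + card (?L {v}) + card ?P"
    by (meson add_le_mono1 card_Un_le le_trans)
  finally show ?thesis using S V P' by linarith
qed

theorem theorem1p4:
  fixes k n :: nat and \<F> :: "nat set set"
  assumes "k \<ge> 2" and "n \<ge> 50 * k^2"
    and "\<F> \<subseteq> k_subsets {1..n} k"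
    and "intersecting \<F>"
  shows "card (intersections \<F>)
     \<le> card (intersections {A \<in> k_subsets {1..n} k. card (A \<inter> {1,2,3}) \<ge> 2})"
proof -
  let ?X = "{1..n}" and ?Y = "{1, 2, 3 :: nat}"
  have "50 * k * 2 \<le> 50 * k * k" using assms(1) by (intro mult_le_mono2)
  then have kn: "100 * k \<le> n" using assms(2) unfolding power2_eq_square by linarith
  then have X: "finite ?X" "card ?X = n" "?X \<noteq> {}" "2 * k \<le> card ?X" and k1: "1 \<le> k"
    and Y: "?Y \<subseteq> ?X" "card ?Y = 3"
    using assms(1) by auto
  obtain \<M> where M: "\<F> \<subseteq> \<M>" "\<M> \<subseteq> k_subsets ?X k" "intersecting \<M>"
    and sat: "\<And>A. A \<in> k_subsets ?X k \<Longrightarrow> intersecting (insert A \<M>) \<Longrightarrow> A \<in> \<M>"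
    using ex_saturated_intersecting[OF X(1) assms(3,4)] by metis
  note int = saturated_covers_intersect[OF X(1,4) k1 M(2,3) sat]
  note finI = finite_intersections[OF X(1) M(2)]
  let ?S = "\<Sum>i\<le>k-2. n choose i" and ?T = "\<Sum>i\<le>k-2. (n - 3) choose i"
  let ?P = "\<lambda>s. \<exists>v\<in>?X. \<forall>T\<in>covers \<M> ?X s. v \<in> T"
  have ST: "8000 * ?S \<le> 9261 * ?T" using kn assms(1) by (intro sum_binomial_le) simp
  have lower: "3 * ?T \<le> card (intersections (two_of_three ?X k ?Y))"
    using card_intersections_two_of_three_ge[OF X(1) Y assms(1) X(4)] X(2) by simp
  have "card (intersections \<M>) \<le> card (intersections (two_of_three ?X k ?Y))"
  proof (cases "?P 2")
    case False
    have "S \<inter> T \<noteq> {}" if "S \<in> covers \<M> ?X 2" "T \<in> covers \<M> ?X 2" for S T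
      using that assms(1) by (intro int) (auto simp: covers_def)
    moreover have "\<exists>T\<in>covers \<M> ?X 2. v \<notin> T" if "v \<in> ?X" for v using False that by blast
    ultimately obtain Y' where Y': "Y' \<subseteq> ?X" "card Y' = 3" "\<M> \<subseteq> two_of_three ?X k Y'"
      using triangle_if_no_common_point[OF X(3,1) M(2)] by metis
    have "card (intersections \<M>) \<le> card (intersections (two_of_three ?X k Y'))"
      using intersections_mono[OF Y'(3)] finite_intersections[OF X(1), of "two_of_three ?X k Y'" k]
      by (intro card_mono) (auto simp: two_of_three_def)
    also have "\<dots> \<le> card (intersections (two_of_three ?X k ?Y))"
      using Y Y' by (intro card_intersections_two_of_three_le[OF X(1)]) simp_all
    finally show ?thesis .
  next
    case P2: True
    have "50 * card (intersections \<M>) \<le> 50 * ?S + 77 * ((n - 1) choose (k - 2))"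
    proof (cases "?P k")
      case True
      then obtain v where v: "v \<in> ?X" "\<forall>T\<in>covers \<M> ?X k. v \<in> T" by blast
      \<comment> \<open>Each member is itself a cover of size \<open>k\<close>, so
        \<open>\<M>\<close> is a star centred at \<open>v\<close>.\<close>
      have vM: "v \<in> F" if "F \<in> \<M>" for F
      proof -
        have "F \<in> covers \<M> ?X k"
          using that M(2,3) unfolding covers_def k_subsets_def intersecting_def by blast
        then show ?thesis using v(2) by blast
      qed
      have vI: "v \<in> I" if "I \<in> intersections \<M>" for I
        using that vM unfolding intersections_def by blast
      \<comment> \<open>Deleting the common point loses no information and leaves at most
        \<open>k - 2\<close> points, so \<open>?S\<close> alone bounds the count.\<close>
      have inj: "inj_on (\<lambda>I. I - {v}) (intersections \<M>)"
        using vI by (intro inj_onI) (metis insert_Diff)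
      have "card (intersections \<M>) \<le> card {I. I \<subseteq> ?X \<and> card I \<le> k - 2}"
      proof (rule card_inj_on_le[OF inj])
        show "(\<lambda>I. I - {v}) ` intersections \<M> \<subseteq> {I. I \<subseteq> ?X \<and> card I \<le> k - 2}"
        proof clarify
          fix I assume I: "I \<in> intersections \<M>"
          have "I \<subseteq> ?X" "card I < k" by (rule intersections_subset_card[OF X(1) M(2) I])+
          moreover have "card (I - {v}) = card I - 1" using vI[OF I] by simp
          ultimately show "I - {v} \<subseteq> ?X \<and> card (I - {v}) \<le> k - 2" by auto
        qed
      qed simp
      then show ?thesis using card_subsets_atMost[OF X(1), of "k - 2"] by simp
    next
      case False
      define m where "m = (LEAST s. \<not> ?P s)"
      have nP: "\<not> ?P m" unfolding m_def using False by (rule LeastI)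
      have mk: "m \<le> k" unfolding m_def using False by (rule Least_le)
      \<comment> \<open>For \<open>m\<close> at most 2, the common point given by \<open>P2\<close>
        would serve for the covers of size at most \<open>m\<close> as well.\<close>
      have m3: "3 \<le> m"
      proof (rule ccontr)
        assume "\<not> 3 \<le> m"
        then have "covers \<M> ?X m \<subseteq> covers \<M> ?X 2" by (auto simp: covers_def)
        then show False using P2 nP by blast
      qed
      then have "m - 1 < m" by simp
      then have "?P (m - 1)" unfolding m_def using not_less_Least by blast
      then obtain v where v: "v \<in> ?X" "\<And>T. T \<in> covers \<M> ?X (m - 1) \<Longrightarrow> v \<in> T" by blast
      have no: "\<exists>T\<in>covers \<M> ?X m. u \<notin> T" if "u \<in> ?X" for u using nP that by blast
      show ?thesis by (rule card_intersections_le[OF X(1,2) assms(2) M(2,3) m3 mk v no])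
    qed
    moreover have "(n - 1) choose (k - 2) \<le> ?S"
    proof -
      have "(n - 1) choose (k - 2) \<le> n choose (k - 2)" by (rule binomial_right_mono) simp
      also have "\<dots> \<le> ?S" by (rule member_le_sum) auto
      finally show ?thesis .
    qed
    \<comment> \<open>The count is at most \<open>127/50 * ?S\<close>, hence at most
      \<open>127/50 * 9261/8000 * ?T\<close>, and this factor is about 2.94, below the 3 of
      \<open>lower\<close>.\<close>
    ultimately show ?thesis using ST lower by linarith
  qed
  moreover have "card (intersections \<F>) \<le> card (intersections \<M>)"
    using intersections_mono[OF M(1)] finI by (rule card_mono[rotated])
  ultimately show ?thesis unfolding two_of_three_def by simp
qed

end
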